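(* Let $d\geq 3$ and $n\geq 2$ be integers and let $x^{(1)},\dots,x^{(n)}$ be drawn independently and uniformly at random from the closed $d$-dimensional unit ball $\overline{\mathrm{B}}_1(0)\subseteq\mathbb{R}^d$. Then $$\mathrm{P}\Bigl[\|x^{(j)}\|\geq 1-\frac{2\ln n}{d}\ \text{ for all } j=1,\dots,n\Bigr]\geq 1-\frac{1}{n}.$$
   Context: $\|\cdot\|$ is the Euclidean norm and $\overline{\mathrm{B}}_1(0)=\{x\in\mathbb{R}^d : \|x\|\leq 1\}$. A random vector $X$ is uniformly distributed on $\overline{\mathrm{B}}_1(0)$ if $\mathrm{P}[X\in A]=\lambda^d(A\cap \overline{\mathrm{B}}_1(0))/\lambda^d(\overline{\mathrm{B}}_1(0))$ for every Borel set $A\subseteq\mathbb{R}^d$, where $\lambda^d$ is $d$-dimensional Lebesgue measure. *)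

theory Defs
  imports "HOL-Probability.Probability"
begin

end

theory Submission
  imports Defs
begin

text \<open>
  By scaling, a uniform point of the unit ball in dimension \<open>d\<close> falls into the concentric ball of
  radius \<open>r\<close> with probability \<open>r ^ d\<close>: in high dimension almost all of the volume lies near the
  sphere. For \<open>r = 1 - t / d\<close> this is at most \<open>exp (- t)\<close>, uniformly in \<open>d\<close>, and the choice
  \<open>t = 2 * ln n\<close> turns the bound into \<open>1 / n ^ 2\<close>. Summed over the \<open>n\<close> points, the union bound
  leaves a failure probability of at most \<open>1 / n\<close>.
\<close>

lemma measure_uniform_unit_ball:
  fixes r :: real
  assumes "0 \<le> r" "r \<le> 1"
  shows "measure (uniform_measure lborel (cball (0::'a::euclidean_space) 1)) (ball 0 r) = r ^ DIM('a)"
proof -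
  have vol: "unit_ball_vol (real DIM('a)) \<noteq> 0"
    using unit_ball_vol_pos[of "real DIM('a)"] by (simp add: less_le)
  have fin: "emeasure lborel (cball (0::'a) 1) \<noteq> \<infinity>"
    by (simp add: emeasure_cball)
  have pos: "emeasure lborel (cball (0::'a) 1) \<noteq> 0"
    using vol by (simp add: emeasure_cball)
  have "cball (0::'a) 1 \<inter> ball 0 r = ball 0 r"
    using assms by auto
  then have "measure (uniform_measure lborel (cball (0::'a) 1)) (ball 0 r)
    = measure lborel (ball (0::'a) r) / measure lborel (cball (0::'a) 1)"
    using measure_uniform_measure[OF pos fin, of "ball 0 r"] by simp
  also have "measure lborel (ball (0::'a) r) = unit_ball_vol (real DIM('a)) * r ^ DIM('a)"
    using content_ball[OF assms(1), of "0::'a"] by (simp add: measure_def)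
  also have "measure lborel (cball (0::'a) 1) = unit_ball_vol (real DIM('a))"
    using content_cball[of 1 "0::'a"] by (simp add: measure_def)
  finally show ?thesis
    using vol by simp
qed

text \<open>
  The bound also covers \<open>t > DIM('a)\<close>, where the inner ball is empty; its volume has to be treated
  apart there, because \<open>(1 - t / d) ^ d\<close> need not be small for a negative base.
\<close>

lemma measure_uniform_inner_ball_le:
  fixes t :: real
  assumes "0 \<le> t"
  shows "measure (uniform_measure lborel (cball (0::'a::euclidean_space) 1))
           (ball 0 (1 - t / DIM('a))) \<le> exp (- t)"
proof (cases "t \<le> DIM('a)")
  case True
  then have "0 \<le> 1 - t / DIM('a)" "1 - t / DIM('a) \<le> 1"
    using assms by simp_all
  then have "measure (uniform_measure lborel (cball (0::'a) 1)) (ball 0 (1 - t / DIM('a)))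
    = (1 - t / DIM('a)) ^ DIM('a)"
    by (rule measure_uniform_unit_ball)
  also have "\<dots> \<le> exp (- t)"
    using True by (intro exp_ge_one_minus_x_over_n_power_n) auto
  finally show ?thesis .
next
  case False
  then have "1 - t / DIM('a) \<le> 0"
    by simp
  then have "ball (0::'a) (1 - t / DIM('a)) = {}"
    by simp
  then show ?thesis
    by (simp only: measure_empty exp_ge_zero)
qed

theorem theorem2p7:
  fixes M :: "'w measure"
    and X :: "nat \<Rightarrow> 'w \<Rightarrow> real ^ 'd"
    and n :: nat
  assumes "prob_space M"
    and "CARD('d) \<ge> 3"
    and "n \<ge> 2"
    and "prob_space.indep_vars M (\<lambda>_. borel) X {1..n}"
    and "\<And>j. j \<in> {1..n} \<Longrightarrow> distr M borel (X j) = uniform_measure lborel (cball 0 1)"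
  shows "\<P>(\<omega> in M. \<forall>j\<in>{1..n}. norm (X j \<omega>) \<ge> 1 - 2 * ln (real n) / real CARD('d)) \<ge> 1 - 1 / real n"
proof -
  interpret prob_space M by fact
  define r where "r = 1 - 2 * ln (real n) / real CARD('d)"
  define B where "B j = X j -` ball 0 r \<inter> space M" for j
  have rv: "X j \<in> borel_measurable M" if "j \<in> {1..n}" for j
    using assms(4) that unfolding indep_vars_def by auto
  have ev: "B j \<in> events" if "j \<in> {1..n}" for j
    unfolding B_def using rv[OF that] by measurable
  have "exp (- (2 * ln (real n))) = 1 / real n ^ 2"
    using assms(3) by (simp add: exp_minus exp_double field_simps)
  moreover have "0 \<le> 2 * ln (real n)"
    using assms(3) by simp
  ultimately have "measure (uniform_measure lborel (cball (0::real^'d) 1)) (ball 0 r) \<le> 1 / real n ^ 2"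
    using measure_uniform_inner_ball_le[where 'a = "real^'d", of "2 * ln (real n)"]
    by (simp add: r_def)
  then have one: "prob (B j) \<le> 1 / real n ^ 2" if "j \<in> {1..n}" for j
    using measure_distr[OF rv[OF that], of "ball 0 r"] assms(5)[OF that] by (simp add: B_def)
  have "prob (\<Union>j\<in>{1..n}. B j) \<le> (\<Sum>j\<in>{1..n}. prob (B j))"
    using ev by (intro finite_measure_subadditive_finite) auto
  also have "\<dots> \<le> (\<Sum>j\<in>{1..n}. 1 / real n ^ 2)"
    by (intro sum_mono one)
  also have "\<dots> = 1 / real n"
    using assms(3) by (simp add: power2_eq_square)
  finally have bad: "prob (\<Union>j\<in>{1..n}. B j) \<le> 1 / real n" .
  have "{\<omega> \<in> space M. \<forall>j\<in>{1..n}. norm (X j \<omega>) \<ge> r} = space M - (\<Union>j\<in>{1..n}. B j)"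
    by (auto simp: B_def not_less)
  moreover have "(\<Union>j\<in>{1..n}. B j) \<in> events"
    using ev by auto
  ultimately show ?thesis
    using bad by (simp add: prob_compl flip: r_def)
qed

end
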